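(* Let $G$ be a countable discrete group and $\sigma$ a family of finite-index subgroups of $G$. Then \[ \operatorname{asdim}(\square_\sigma G)=\sup_{\tau}\operatorname{asdim}(\square_\tau G), \] where the supremum is over all countable subfamilies $\tau\subset\sigma$. Moreover, if $\sigma$ is nested, then the supremum may be taken over all nested countable subfamilies $\tau\subset\sigma$.
   Context: A coarse space is a set $X$ with a collection $\mathcal E$ of subsets of $X\times X$ (entourages) that contains the diagonal and is closed under subsets, finite unions, inverses and compositions. It is connected if $\{(x,y)\}\in\mathcal E$ for all $x,y\in X$. A coarse space $(X,\mathcal E)$ has $\operatorname{asdim}(X)\le n$ if for every $E\in\mathcal E$ there is a cover $\mathcal U$ of $X$ such that $\bigcup_{U\in\mathcal U}U\times U\in\mathcal E$, any $n+2$ distinct members of $\mathcal U$ have empty intersection, and every non-empty $A\subseteq X$ with $A\times A\subseteq E$ is contained in some $U\in\mathcal U$. $\operatorname{asdim}(X)\in\{0,1,2,\dots\}\cup\{\infty\}$ is the least such $n$, or $\infty$ if there is none. Let $G$ be a countable discrete group and $\sigma=(G_\alpha)_\alpha$ a family (repetitions allowed) of finite-index, not necessarily normal, subgroups. The box space $\square_\sigma G$ is the set $\bigsqcup_\alpha G/G_\alpha$ (left cosets, with $G$ acting by left multiplication) equipped with the smallest connected $G$-invariant coarse structure containing the sets $\Delta_g=\{(x,gx) : x\in\bigsqcup_\alpha G/G_\alpha\}$ for all $g\in G$. A family of subgroups is nested if for any two of its members there is a member contained in both (i.e. it is directed under reverse inclusion). *)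

theory Defs
  imports "HOL-Algebra.Left_Coset" "HOL-Library.Extended_Nat" "HOL-Library.Countable_Set"
begin

definition coarse_structure :: "'x set \<Rightarrow> ('x \<times> 'x) set set \<Rightarrow> bool" where
  "coarse_structure X \<E> \<longleftrightarrow>
     \<E> \<subseteq> Pow (X \<times> X) \<and>
     Id_on X \<in> \<E> \<and>
     (\<forall>E\<in>\<E>. \<forall>F. F \<subseteq> E \<longrightarrow> F \<in> \<E>) \<and>
     (\<forall>E\<in>\<E>. \<forall>F\<in>\<E>. E \<union> F \<in> \<E>) \<and>
     (\<forall>E\<in>\<E>. E\<inverse> \<in> \<E>) \<and>
     (\<forall>E\<in>\<E>. \<forall>F\<in>\<E>. E O F \<in> \<E>)"

definition coarsely_connected :: "'x set \<Rightarrow> ('x \<times> 'x) set set \<Rightarrow> bool" where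
  "coarsely_connected X \<E> \<longleftrightarrow> (\<forall>x\<in>X. \<forall>y\<in>X. {(x, y)} \<in> \<E>)"

definition asdim_le :: "'x set \<Rightarrow> ('x \<times> 'x) set set \<Rightarrow> nat \<Rightarrow> bool" where
  "asdim_le X \<E> n \<longleftrightarrow>
     (\<forall>E\<in>\<E>. \<exists>\<U>. \<U> \<subseteq> Pow X \<and> \<Union>\<U> = X \<and>
        (\<Union>U\<in>\<U>. U \<times> U) \<in> \<E> \<and>
        (\<forall>\<V>. \<V> \<subseteq> \<U> \<and> card \<V> = n + 2 \<longrightarrow> \<Inter>\<V> = {}) \<and>
        (\<forall>A. A \<noteq> {} \<and> A \<subseteq> X \<and> A \<times> A \<subseteq> E \<longrightarrow> (\<exists>U\<in>\<U>. A \<subseteq> U)))"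

definition asdim :: "'x set \<Rightarrow> ('x \<times> 'x) set set \<Rightarrow> enat" where
  "asdim X \<E> =
     (if \<exists>n. asdim_le X \<E> n then enat (LEAST n. asdim_le X \<E> n) else \<infinity>)"

text \<open>
  A family of subgroups is an indexed family \<open>H i\<close>, \<open>i \<in> I\<close>, so repetitions are allowed;
  its subfamilies are the restrictions of \<open>H\<close> to subsets of \<open>I\<close>. Points of the disjoint union
  of the coset spaces are pairs of an index and a left coset.
\<close>

definition box_points :: "('a, 'b) monoid_scheme \<Rightarrow> 'i set \<Rightarrow> ('i \<Rightarrow> 'a set) \<Rightarrow> ('i \<times> 'a set) set" where
  "box_points G I H = (SIGMA i:I. lcosets\<^bsub>G\<^esub> (H i))"

definition box_act :: "('a, 'b) monoid_scheme \<Rightarrow> 'a \<Rightarrow> 'i \<times> 'a set \<Rightarrow> 'i \<times> 'a set" where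
  "box_act G g x = (fst x, g <#\<^bsub>G\<^esub> snd x)"

text \<open>
  Invariance means that every translate \<open>gE\<close> of an entourage is an entourage. The union of all
  translates of one entourage need not be an entourage.
\<close>

definition box_invariant :: "('a, 'b) monoid_scheme \<Rightarrow> (('i \<times> 'a set) \<times> ('i \<times> 'a set)) set set \<Rightarrow> bool" where
  "box_invariant G \<E> \<longleftrightarrow>
     (\<forall>g\<in>carrier G. \<forall>E\<in>\<E>. map_prod (box_act G g) (box_act G g) ` E \<in> \<E>)"

definition box_Delta ::
  "('a, 'b) monoid_scheme \<Rightarrow> 'i set \<Rightarrow> ('i \<Rightarrow> 'a set) \<Rightarrow> 'a \<Rightarrow> (('i \<times> 'a set) \<times> ('i \<times> 'a set)) set" where
  "box_Delta G I H g = {(x, box_act G g x) | x. x \<in> box_points G I H}"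

definition box_structures ::
  "('a, 'b) monoid_scheme \<Rightarrow> 'i set \<Rightarrow> ('i \<Rightarrow> 'a set) \<Rightarrow> (('i \<times> 'a set) \<times> ('i \<times> 'a set)) set set set" where
  "box_structures G I H =
     {\<E>. coarse_structure (box_points G I H) \<E> \<and>
          coarsely_connected (box_points G I H) \<E> \<and>
          box_invariant G \<E> \<and>
          (\<forall>g\<in>carrier G. box_Delta G I H g \<in> \<E>)}"

definition box_coarse ::
  "('a, 'b) monoid_scheme \<Rightarrow> 'i set \<Rightarrow> ('i \<Rightarrow> 'a set) \<Rightarrow> (('i \<times> 'a set) \<times> ('i \<times> 'a set)) set set" where
  "box_coarse G I H = \<Inter> (box_structures G I H)"

definition box_asdim :: "('a, 'b) monoid_scheme \<Rightarrow> 'i set \<Rightarrow> ('i \<Rightarrow> 'a set) \<Rightarrow> enat" where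
  "box_asdim G I H = asdim (box_points G I H) (box_coarse G I H)"

definition nested_family :: "'i set \<Rightarrow> ('i \<Rightarrow> 'a set) \<Rightarrow> bool" where
  "nested_family I H \<longleftrightarrow> (\<forall>i\<in>I. \<forall>j\<in>I. \<exists>k\<in>I. H k \<subseteq> H i \<inter> H j)"

lemma box_act_in_points:
  assumes G: "group G" and sub: "\<And>i. i \<in> I \<Longrightarrow> subgroup (H i) G"
    and g: "g \<in> carrier G" and x: "x \<in> box_points G I H"
  shows "box_act G g x \<in> box_points G I H"
proof -
  obtain i a where i: "i \<in> I" and a: "a \<in> carrier G" and x': "x = (i, a <#\<^bsub>G\<^esub> H i)"
    using x by (auto simp: box_points_def LCOSETS_def)
  have "g <#\<^bsub>G\<^esub> (a <#\<^bsub>G\<^esub> H i) = (g \<otimes>\<^bsub>G\<^esub> a) <#\<^bsub>G\<^esub> H i"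
    using group.lcos_m_assoc[OF G subgroup.subset[OF sub[OF i]] g a] by simp
  moreover have "g \<otimes>\<^bsub>G\<^esub> a \<in> carrier G"
    using G g a by (simp add: group.is_monoid monoid.m_closed)
  ultimately show ?thesis
    using i x' by (auto simp: box_points_def box_act_def LCOSETS_def)
qed

text \<open>The intersection in \<open>box_coarse\<close> is indeed the least of the structures it ranges over.\<close>

lemma box_coarse_least:
  assumes G: "group G" and sub: "\<And>i. i \<in> I \<Longrightarrow> subgroup (H i) G"
  shows "box_coarse G I H \<in> box_structures G I H"
    and "\<E> \<in> box_structures G I H \<Longrightarrow> box_coarse G I H \<subseteq> \<E>"
proof -
  let ?X = "box_points G I H"
  have act: "box_act G g x \<in> ?X" if "g \<in> carrier G" "x \<in> ?X" for g x
    using box_act_in_points[OF G sub that] by simp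
  have "coarse_structure ?X (Pow (?X \<times> ?X))"
    unfolding coarse_structure_def by (intro conjI; blast)
  moreover have "coarsely_connected ?X (Pow (?X \<times> ?X))"
    unfolding coarsely_connected_def by blast
  moreover have "box_invariant G (Pow (?X \<times> ?X))"
    unfolding box_invariant_def using act by (clarsimp simp: subset_iff)
  moreover have "\<forall>g\<in>carrier G. box_Delta G I H g \<in> Pow (?X \<times> ?X)"
    unfolding box_Delta_def using act by blast
  ultimately have top: "Pow (?X \<times> ?X) \<in> box_structures G I H"
    unfolding box_structures_def by blast
  let ?C = "box_coarse G I H"
  have C: "E \<in> ?C \<longleftrightarrow> (\<forall>\<E>\<in>box_structures G I H. E \<in> \<E>)" for E
    by (simp add: box_coarse_def)
  have str: "coarse_structure ?X \<E>" "coarsely_connected ?X \<E>" "box_invariant G \<E>"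
    "\<forall>g\<in>carrier G. box_Delta G I H g \<in> \<E>" if "\<E> \<in> box_structures G I H" for \<E>
    using that by (simp_all add: box_structures_def)
  have "coarse_structure ?X ?C"
    unfolding coarse_structure_def
  proof (intro conjI ballI allI impI)
    show "?C \<subseteq> Pow (?X \<times> ?X)"
      using top by (auto simp: box_coarse_def)
    show "Id_on ?X \<in> ?C"
      unfolding C using str(1) by (simp add: coarse_structure_def)
    show "F \<in> ?C" if "E \<in> ?C" "F \<subseteq> E" for E F
      using that str(1) unfolding C coarse_structure_def by meson
    show "E \<union> F \<in> ?C" if "E \<in> ?C" "F \<in> ?C" for E F
      using that str(1) unfolding C coarse_structure_def by simp
    show "E\<inverse> \<in> ?C" if "E \<in> ?C" for E
      using that str(1) unfolding C coarse_structure_def by simp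
    show "E O F \<in> ?C" if "E \<in> ?C" "F \<in> ?C" for E F
      using that str(1) unfolding C coarse_structure_def by simp
  qed
  moreover have "coarsely_connected ?X ?C"
    using str(2) unfolding coarsely_connected_def C by simp
  moreover have "box_invariant G ?C"
    using str(3) by (simp add: box_invariant_def C)
  moreover have "\<forall>g\<in>carrier G. box_Delta G I H g \<in> ?C"
    using str(4) unfolding C by simp
  ultimately show "?C \<in> box_structures G I H"
    unfolding box_structures_def by simp
  show "\<E> \<in> box_structures G I H \<Longrightarrow> box_coarse G I H \<subseteq> \<E>"
    by (auto simp: box_coarse_def)
qed

end

theory Submission
  imports Defs
begin

text \<open>
  The entourages of \<open>\<square>\<^sub>\<sigma> G\<close> are the sets of pairs that lie, up to finitely many of the
  coset spaces, in finitely many of the sets \<open>\<Delta>\<^sub>g\<close>. Hence \<open>asdim(\<square>\<^sub>\<sigma> G) \<le> n\<close> says: for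
  every finite \<open>S \<subseteq> G\<close> there is a finite \<open>T \<subseteq> G\<close> such that all but finitely many of the spaces
  \<open>G/G\<^sub>\<alpha>\<close> admit a \<open>T\<close>-bounded cover of multiplicity at most \<open>n + 1\<close> and Lebesgue scale \<open>S\<close>.
  If this fails for some \<open>S\<close>, choose for each of the countably many \<open>T\<close> a countably infinite set
  of indices \<open>\<alpha>\<close> without such a cover; the union of these sets is a countable subfamily of
  asymptotic dimension greater than \<open>n\<close>. A countable subfamily of a nested family is enlarged to
  a countable nested one by closing it under a choice of lower bounds.
\<close>

section \<open>Covers of bounded multiplicity\<close>

definition has_cover :: "'x set \<Rightarrow> ('x \<times> 'x) set \<Rightarrow> ('x \<times> 'x) set \<Rightarrow> nat \<Rightarrow> bool" where
  "has_cover X E F n \<longleftrightarrow>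
     (\<exists>\<U>. \<U> \<subseteq> Pow X \<and> \<Union>\<U> = X \<and> (\<forall>U\<in>\<U>. U \<times> U \<subseteq> F) \<and>
        (\<forall>\<V>. \<V> \<subseteq> \<U> \<and> card \<V> = n + 2 \<longrightarrow> \<Inter>\<V> = {}) \<and>
        (\<forall>A. A \<noteq> {} \<and> A \<subseteq> X \<and> A \<times> A \<subseteq> E \<longrightarrow> (\<exists>U\<in>\<U>. A \<subseteq> U)))"

lemma has_coverI:
  assumes "\<U> \<subseteq> Pow X" "\<Union>\<U> = X" "\<And>U. U \<in> \<U> \<Longrightarrow> U \<times> U \<subseteq> F"
    and "\<And>\<V>. \<V> \<subseteq> \<U> \<Longrightarrow> card \<V> = n + 2 \<Longrightarrow> \<Inter>\<V> = {}"
    and "\<And>A. A \<noteq> {} \<Longrightarrow> A \<subseteq> X \<Longrightarrow> A \<times> A \<subseteq> E \<Longrightarrow> \<exists>U\<in>\<U>. A \<subseteq> U"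
  shows "has_cover X E F n"
  unfolding has_cover_def using assms by (intro exI[of _ \<U>]) simp

lemma has_coverE:
  assumes "has_cover X E F n"
  obtains \<U> where "\<U> \<subseteq> Pow X" "\<Union>\<U> = X" "\<forall>U\<in>\<U>. U \<times> U \<subseteq> F"
    and "\<forall>\<V>. \<V> \<subseteq> \<U> \<and> card \<V> = n + 2 \<longrightarrow> \<Inter>\<V> = {}"
    and "\<forall>A. A \<noteq> {} \<and> A \<subseteq> X \<and> A \<times> A \<subseteq> E \<longrightarrow> (\<exists>U\<in>\<U>. A \<subseteq> U)"
  using assms unfolding has_cover_def by (elim exE conjE)

lemma asdim_le_iff_has_cover:
  assumes "coarse_structure X \<E>"
  shows "asdim_le X \<E> n \<longleftrightarrow> (\<forall>E\<in>\<E>. \<exists>F\<in>\<E>. has_cover X E F n)"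
proof -
  have down: "F' \<in> \<E>" if "F \<in> \<E>" "F' \<subseteq> F" for F F'
    using assms that unfolding coarse_structure_def by meson
  show ?thesis
  proof
    assume L: "asdim_le X \<E> n"
    show "\<forall>E\<in>\<E>. \<exists>F\<in>\<E>. has_cover X E F n"
    proof
      fix E assume "E \<in> \<E>"
      obtain \<U> where \<U>: "\<U> \<subseteq> Pow X" "\<Union>\<U> = X" "(\<Union>U\<in>\<U>. U \<times> U) \<in> \<E>"
        "\<forall>\<V>. \<V> \<subseteq> \<U> \<and> card \<V> = n + 2 \<longrightarrow> \<Inter>\<V> = {}"
        "\<forall>A. A \<noteq> {} \<and> A \<subseteq> X \<and> A \<times> A \<subseteq> E \<longrightarrow> (\<exists>U\<in>\<U>. A \<subseteq> U)"
        using bspec[OF L[unfolded asdim_le_def] \<open>E \<in> \<E>\<close>] by (elim exE conjE)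
      have "has_cover X E (\<Union>U\<in>\<U>. U \<times> U) n"
        by (rule has_coverI[of \<U>]) (use \<U> in auto)
      with \<U>(3) show "\<exists>F\<in>\<E>. has_cover X E F n" ..
    qed
  next
    assume R: "\<forall>E\<in>\<E>. \<exists>F\<in>\<E>. has_cover X E F n"
    show "asdim_le X \<E> n"
      unfolding asdim_le_def
    proof
      fix E assume "E \<in> \<E>"
      with R obtain F where "F \<in> \<E>" "has_cover X E F n" by blast
      obtain \<U> where \<U>: "\<U> \<subseteq> Pow X" "\<Union>\<U> = X" "\<forall>U\<in>\<U>. U \<times> U \<subseteq> F"
        "\<forall>\<V>. \<V> \<subseteq> \<U> \<and> card \<V> = n + 2 \<longrightarrow> \<Inter>\<V> = {}"
        "\<forall>A. A \<noteq> {} \<and> A \<subseteq> X \<and> A \<times> A \<subseteq> E \<longrightarrow> (\<exists>U\<in>\<U>. A \<subseteq> U)"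
        using \<open>has_cover X E F n\<close> by (rule has_coverE)
      have "(\<Union>U\<in>\<U>. U \<times> U) \<in> \<E>"
        using \<U>(3) by (intro down[OF \<open>F \<in> \<E>\<close>] UN_least) simp
      then show "\<exists>\<U>. \<U> \<subseteq> Pow X \<and> \<Union>\<U> = X \<and> (\<Union>U\<in>\<U>. U \<times> U) \<in> \<E> \<and>
          (\<forall>\<V>. \<V> \<subseteq> \<U> \<and> card \<V> = n + 2 \<longrightarrow> \<Inter>\<V> = {}) \<and>
          (\<forall>A. A \<noteq> {} \<and> A \<subseteq> X \<and> A \<times> A \<subseteq> E \<longrightarrow> (\<exists>U\<in>\<U>. A \<subseteq> U))"
        by (intro exI[of _ \<U>] conjI \<U>)
    qed
  qed
qed

lemma has_cover_mono:
  assumes "has_cover X E F n" "E' \<inter> X \<times> X \<subseteq> E" "F \<inter> X \<times> X \<subseteq> F'"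
  shows "has_cover X E' F' n"
proof -
  obtain \<U> where \<U>: "\<U> \<subseteq> Pow X" "\<Union>\<U> = X" "\<forall>U\<in>\<U>. U \<times> U \<subseteq> F"
    "\<forall>\<V>. \<V> \<subseteq> \<U> \<and> card \<V> = n + 2 \<longrightarrow> \<Inter>\<V> = {}"
    "\<forall>A. A \<noteq> {} \<and> A \<subseteq> X \<and> A \<times> A \<subseteq> E \<longrightarrow> (\<exists>U\<in>\<U>. A \<subseteq> U)"
    using assms(1) by (rule has_coverE)
  show ?thesis
  proof (rule has_coverI[of \<U>])
    show "U \<times> U \<subseteq> F'" if "U \<in> \<U>" for U
      using \<U>(1,3) that assms(3) by blast
    show "\<exists>U\<in>\<U>. A \<subseteq> U" if "A \<noteq> {}" "A \<subseteq> X" "A \<times> A \<subseteq> E'" for A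
    proof -
      have "A \<times> A \<subseteq> E"
        using that assms(2) by blast
      with \<U>(5) that show ?thesis by blast
    qed
  qed (simp_all add: \<U>)
qed

lemma has_cover_subset:
  assumes "has_cover X E F n" "Z \<subseteq> X"
  shows "has_cover Z E F n"
proof -
  obtain \<U> where \<U>: "\<U> \<subseteq> Pow X" "\<Union>\<U> = X" "\<forall>U\<in>\<U>. U \<times> U \<subseteq> F"
    "\<forall>\<V>. \<V> \<subseteq> \<U> \<and> card \<V> = n + 2 \<longrightarrow> \<Inter>\<V> = {}"
    "\<forall>A. A \<noteq> {} \<and> A \<subseteq> X \<and> A \<times> A \<subseteq> E \<longrightarrow> (\<exists>U\<in>\<U>. A \<subseteq> U)"
    using assms(1) by (rule has_coverE)
  show ?thesis
  proof (rule has_coverI[of "(\<lambda>U. U \<inter> Z) ` \<U>"])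
    show "(\<lambda>U. U \<inter> Z) ` \<U> \<subseteq> Pow Z"
      by auto
    show "\<Union>((\<lambda>U. U \<inter> Z) ` \<U>) = Z"
      using \<U>(2) assms(2) by blast
    show "U \<times> U \<subseteq> F" if U: "U \<in> (\<lambda>U. U \<inter> Z) ` \<U>" for U
    proof -
      obtain W where "W \<in> \<U>" "U = W \<inter> Z" using U by blast
      moreover from this have "W \<times> W \<subseteq> F" using \<U>(3) by simp
      ultimately show ?thesis by blast
    qed
    show "\<Inter>\<V> = {}" if V: "\<V> \<subseteq> (\<lambda>U. U \<inter> Z) ` \<U>" "card \<V> = n + 2" for \<V>
    proof -
      obtain \<W> where W: "\<W> \<subseteq> \<U>" "inj_on (\<lambda>U. U \<inter> Z) \<W>" "\<V> = (\<lambda>U. U \<inter> Z) ` \<W>"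
        using V(1) unfolding subset_image_inj by blast
      then have "card \<W> = n + 2"
        using V(2) card_image by fastforce
      then have "\<Inter>\<W> = {}" "\<W> \<noteq> {}"
        using \<U>(4) W(1) by auto
      then show ?thesis
        unfolding W(3) by blast
    qed
    show "\<exists>U\<in>(\<lambda>U. U \<inter> Z) ` \<U>. A \<subseteq> U" if A: "A \<noteq> {}" "A \<subseteq> Z" "A \<times> A \<subseteq> E" for A
    proof -
      have "A \<subseteq> X" using A(2) assms(2) by (rule order.trans)
      with \<U>(5) A have "\<exists>U\<in>\<U>. A \<subseteq> U" by simp
      with A(2) show ?thesis by simp
    qed
  qed
qed

lemma has_cover_mono_dim:
  assumes "has_cover X E F m" "m \<le> n"
  shows "has_cover X E F n"
proof -
  obtain \<U> where \<U>: "\<U> \<subseteq> Pow X" "\<Union>\<U> = X" "\<forall>U\<in>\<U>. U \<times> U \<subseteq> F"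
    "\<forall>\<V>. \<V> \<subseteq> \<U> \<and> card \<V> = m + 2 \<longrightarrow> \<Inter>\<V> = {}"
    "\<forall>A. A \<noteq> {} \<and> A \<subseteq> X \<and> A \<times> A \<subseteq> E \<longrightarrow> (\<exists>U\<in>\<U>. A \<subseteq> U)"
    using assms(1) by (rule has_coverE)
  show ?thesis
  proof (rule has_coverI[of \<U>])
    show "\<Inter>\<V> = {}" if "\<V> \<subseteq> \<U>" "card \<V> = n + 2" for \<V>
    proof -
      obtain \<W> where "\<W> \<subseteq> \<V>" "card \<W> = m + 2"
        using obtain_subset_with_card_n[of "m + 2" \<V>] \<open>card \<V> = n + 2\<close> assms(2) by auto
      then have "\<Inter>\<W> = {}"
        using \<U>(4) \<open>\<V> \<subseteq> \<U>\<close> by blast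
      with \<open>\<W> \<subseteq> \<V>\<close> show ?thesis by blast
    qed
  qed (simp_all add: \<U>)
qed

lemma has_cover_self: "has_cover X E (X \<times> X) n"
proof (rule has_coverI[of "{X}"])
  show "\<Inter>\<V> = {}" if "\<V> \<subseteq> {X}" "card \<V> = n + 2" for \<V>
    using card_mono[OF _ that(1)] that(2) by simp
qed auto

lemma has_cover_Union:
  assumes "pairwise disjnt \<P>" and "E \<inter> \<Union>\<P> \<times> \<Union>\<P> \<subseteq> (\<Union>P\<in>\<P>. P \<times> P)"
    and "\<And>P. P \<in> \<P> \<Longrightarrow> has_cover P E F n"
  shows "has_cover (\<Union>\<P>) E F n"
proof -
  have "\<forall>P\<in>\<P>. \<exists>\<U>. \<U> \<subseteq> Pow P \<and> \<Union>\<U> = P \<and> (\<forall>U\<in>\<U>. U \<times> U \<subseteq> F) \<and>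
        (\<forall>\<V>. \<V> \<subseteq> \<U> \<and> card \<V> = n + 2 \<longrightarrow> \<Inter>\<V> = {}) \<and>
        (\<forall>A. A \<noteq> {} \<and> A \<subseteq> P \<and> A \<times> A \<subseteq> E \<longrightarrow> (\<exists>U\<in>\<U>. A \<subseteq> U))"
    using assms(3) unfolding has_cover_def by (rule ballI)
  from bchoice[OF this] obtain \<U> where \<U>: "\<forall>P\<in>\<P>. \<U> P \<subseteq> Pow P \<and> \<Union>(\<U> P) = P \<and> (\<forall>U\<in>\<U> P. U \<times> U \<subseteq> F) \<and>
        (\<forall>\<V>. \<V> \<subseteq> \<U> P \<and> card \<V> = n + 2 \<longrightarrow> \<Inter>\<V> = {}) \<and>
        (\<forall>A. A \<noteq> {} \<and> A \<subseteq> P \<and> A \<times> A \<subseteq> E \<longrightarrow> (\<exists>U\<in>\<U> P. A \<subseteq> U))"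
    by (elim exE)
  have disj: "P = Q" if "P \<in> \<P>" "Q \<in> \<P>" "x \<in> P" "x \<in> Q" for P Q x
    using assms(1) that by (auto simp: pairwise_def disjnt_iff)
  have sub: "U \<subseteq> P" if "P \<in> \<P>" "U \<in> \<U> P" for P U
  proof -
    have "\<U> P \<subseteq> Pow P" using \<U> that(1) by simp
    with that(2) show ?thesis by blast
  qed
  show ?thesis
  proof (rule has_coverI[of "\<Union>P\<in>\<P>. \<U> P"])
    show "(\<Union>P\<in>\<P>. \<U> P) \<subseteq> Pow (\<Union>\<P>)"
      using sub by blast
    show "\<Union>(\<Union>P\<in>\<P>. \<U> P) = \<Union>\<P>"
    proof -
      have "\<Union>(\<Union>P\<in>\<P>. \<U> P) = (\<Union>P\<in>\<P>. \<Union>(\<U> P))" by blast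
      also have "\<dots> = (\<Union>P\<in>\<P>. P)" using \<U> by (intro SUP_cong) auto
      finally show ?thesis by simp
    qed
    show "U \<times> U \<subseteq> F" if "U \<in> (\<Union>P\<in>\<P>. \<U> P)" for U
      using that by (rule UN_E) (use \<U> in simp)
    show "\<Inter>\<V> = {}" if V: "\<V> \<subseteq> (\<Union>P\<in>\<P>. \<U> P)" "card \<V> = n + 2" for \<V>
    proof (rule ccontr)
      assume "\<Inter>\<V> \<noteq> {}"
      then obtain x where x: "\<And>V. V \<in> \<V> \<Longrightarrow> x \<in> V" by blast
      from V(2) have "\<V> \<noteq> {}" by auto
      then obtain V P where "V \<in> \<V>" "P \<in> \<P>" "V \<in> \<U> P"
        using V(1) by blast
      then have "x \<in> P" using sub x by blast
      have "\<V> \<subseteq> \<U> P"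
      proof
        fix W assume "W \<in> \<V>"
        then obtain Q where Q: "Q \<in> \<P>" "W \<in> \<U> Q" using V(1) by blast
        then have "x \<in> Q" using sub x \<open>W \<in> \<V>\<close> by blast
        then have "Q = P" using disj Q(1) \<open>P \<in> \<P>\<close> \<open>x \<in> P\<close> by blast
        then show "W \<in> \<U> P" using Q by simp
      qed
      then have "\<Inter>\<V> = {}" using bspec[OF \<U> \<open>P \<in> \<P>\<close>] V(2) by simp
      with \<open>\<Inter>\<V> \<noteq> {}\<close> show False by simp
    qed
    show "\<exists>U\<in>(\<Union>P\<in>\<P>. \<U> P). A \<subseteq> U" if A: "A \<noteq> {}" "A \<subseteq> \<Union>\<P>" "A \<times> A \<subseteq> E" for A
    proof -
      obtain a P where a: "a \<in> A" "a \<in> P" "P \<in> \<P>" using A by blast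
      have "A \<subseteq> P"
      proof
        fix b assume "b \<in> A"
        then have "(a, b) \<in> E \<inter> \<Union>\<P> \<times> \<Union>\<P>"
          using subsetD[OF A(2)] subsetD[OF A(3)] a(1) by simp
        with assms(2) have "(a, b) \<in> (\<Union>P\<in>\<P>. P \<times> P)" by (rule subsetD)
        then obtain Q where "Q \<in> \<P>" "a \<in> Q" "b \<in> Q" by auto
        then show "b \<in> P" using disj a by blast
      qed
      then have "\<exists>U\<in>\<U> P. A \<subseteq> U" using bspec[OF \<U> a(3)] A by simp
      then show ?thesis using a(3) by blast
    qed
  qed
qed

lemma enat_le_by_bounds:
  fixes x y :: enat
  assumes "\<And>n. y \<le> enat n \<Longrightarrow> x \<le> enat n"
  shows "x \<le> y"
  using assms by (cases y) auto

lemma asdim_le_mono: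
  assumes "coarse_structure X \<E>" "asdim_le X \<E> m" "m \<le> n"
  shows "asdim_le X \<E> n"
  using assms has_cover_mono_dim unfolding asdim_le_iff_has_cover[OF assms(1)] by blast

lemma asdim_leq_iff:
  assumes "coarse_structure X \<E>"
  shows "asdim X \<E> \<le> enat n \<longleftrightarrow> asdim_le X \<E> n"
proof
  assume "asdim X \<E> \<le> enat n"
  then have ex: "\<exists>m. asdim_le X \<E> m" and le: "(LEAST m. asdim_le X \<E> m) \<le> n"
    by (auto simp: asdim_def split: if_splits)
  have "asdim_le X \<E> (LEAST m. asdim_le X \<E> m)"
    using ex by (rule LeastI_ex)
  then show "asdim_le X \<E> n"
    using asdim_le_mono[OF assms] le by blast
next
  assume "asdim_le X \<E> n"
  then show "asdim X \<E> \<le> enat n"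
    by (auto simp: asdim_def intro: Least_le)
qed

section \<open>Entourages of box spaces\<close>

definition orbit_rel :: "('a, 'b) monoid_scheme \<Rightarrow> 'a set \<Rightarrow> (('i \<times> 'a set) \<times> ('i \<times> 'a set)) set" where
  "orbit_rel G S = {(x, y). \<exists>g\<in>S. y = box_act G g x}"

lemma orbit_rel_mono: "S \<subseteq> T \<Longrightarrow> orbit_rel G S \<subseteq> orbit_rel G T"
  unfolding orbit_rel_def by blast

lemma orbit_rel_fst: "(x, y) \<in> orbit_rel G S \<Longrightarrow> fst y = fst x"
  by (auto simp: orbit_rel_def box_act_def)

lemma box_points_mono: "J \<subseteq> I \<Longrightarrow> box_points G J H \<subseteq> box_points G I H"
  by (auto simp: box_points_def)

lemma box_points_fst: "x \<in> box_points G I H \<Longrightarrow> x \<in> box_points G J H \<longleftrightarrow> fst x \<in> J"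
  by (auto simp: box_points_def)

locale box_family = group G for G :: "('a, 'b) monoid_scheme" +
  fixes I :: "'i set" and H :: "'i \<Rightarrow> 'a set"
  assumes sub: "i \<in> I \<Longrightarrow> subgroup (H i) G"
    and fin: "i \<in> I \<Longrightarrow> finite (lcosets\<^bsub>G\<^esub> (H i))"
begin

lemma box_family_subset: "J \<subseteq> I \<Longrightarrow> box_family G J H"
  using sub fin by (intro box_family.intro box_family_axioms.intro is_group) auto

lemma finite_box_points: "finite K \<Longrightarrow> K \<subseteq> I \<Longrightarrow> finite (box_points G K H)"
  unfolding box_points_def using fin by (intro finite_SigmaI) auto

lemma snd_box_points: "x \<in> box_points G I H \<Longrightarrow> snd x \<subseteq> carrier G"
  using sub unfolding box_points_def LCOSETS_def l_coset_def
  by (fastforce dest: subgroup.mem_carrier)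

lemma box_act_one: "x \<in> box_points G I H \<Longrightarrow> box_act G \<one>\<^bsub>G\<^esub> x = x"
  using snd_box_points[of x] by (simp add: box_act_def lcos_mult_one)

lemma box_act_mult:
  "x \<in> box_points G I H \<Longrightarrow> g \<in> carrier G \<Longrightarrow> h \<in> carrier G \<Longrightarrow>
   box_act G g (box_act G h x) = box_act G (g \<otimes>\<^bsub>G\<^esub> h) x"
  using snd_box_points[of x] by (simp add: box_act_def lcos_m_assoc)

lemma box_act_closed: "g \<in> carrier G \<Longrightarrow> x \<in> box_points G I H \<Longrightarrow> box_act G g x \<in> box_points G I H"
  by (rule box_act_in_points[OF is_group sub])

lemma box_act_closed_subset:
  "g \<in> carrier G \<Longrightarrow> K \<subseteq> I \<Longrightarrow> x \<in> box_points G K H \<Longrightarrow> box_act G g x \<in> box_points G K H"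
  using box_act_in_points[OF is_group, of K H] sub by blast

lemma coarse_structure_box: "coarse_structure (box_points G I H) (box_coarse G I H)"
  using box_coarse_least(1)[of G I H, OF is_group sub] by (simp add: box_structures_def)

definition box_entourages :: "(('i \<times> 'a set) \<times> ('i \<times> 'a set)) set set" where
  "box_entourages = {E. E \<subseteq> box_points G I H \<times> box_points G I H \<and>
     (\<exists>S K. finite S \<and> S \<subseteq> carrier G \<and> finite K \<and> K \<subseteq> I \<and>
        E \<subseteq> orbit_rel G S \<union> box_points G K H \<times> box_points G K H)}"

lemma box_entouragesI:
  "E \<subseteq> box_points G I H \<times> box_points G I H \<Longrightarrow> finite S \<Longrightarrow> S \<subseteq> carrier G \<Longrightarrow> finite K \<Longrightarrow> K \<subseteq> I \<Longrightarrow>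
   E \<subseteq> orbit_rel G S \<union> box_points G K H \<times> box_points G K H \<Longrightarrow> E \<in> box_entourages"
  unfolding box_entourages_def by blast

lemma box_entouragesE:
  assumes "E \<in> box_entourages"
  obtains S K where "E \<subseteq> box_points G I H \<times> box_points G I H" "finite S" "S \<subseteq> carrier G"
    "finite K" "K \<subseteq> I" "E \<subseteq> orbit_rel G S \<union> box_points G K H \<times> box_points G K H"
  using assms unfolding box_entourages_def by blast

lemma box_entourages_Un:
  assumes "E \<in> box_entourages" "F \<in> box_entourages"
  shows "E \<union> F \<in> box_entourages"
proof -
  from assms(1) obtain S K where E: "E \<subseteq> box_points G I H \<times> box_points G I H" "finite S" "S \<subseteq> carrier G"
    "finite K" "K \<subseteq> I" "E \<subseteq> orbit_rel G S \<union> box_points G K H \<times> box_points G K H"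
    by (rule box_entouragesE)
  from assms(2) obtain T L where F: "F \<subseteq> box_points G I H \<times> box_points G I H" "finite T" "T \<subseteq> carrier G"
    "finite L" "L \<subseteq> I" "F \<subseteq> orbit_rel G T \<union> box_points G L H \<times> box_points G L H"
    by (rule box_entouragesE)
  have "E \<union> F \<subseteq> orbit_rel G (S \<union> T) \<union> box_points G (K \<union> L) H \<times> box_points G (K \<union> L) H"
    using E(6) F(6) orbit_rel_mono[of S "S \<union> T" G] orbit_rel_mono[of T "S \<union> T" G]
      box_points_mono[of K "K \<union> L" G H] box_points_mono[of L "K \<union> L" G H] by blast
  then show ?thesis
    using E F by (intro box_entouragesI[of _ "S \<union> T" "K \<union> L"]) auto
qed

lemma box_entourages_converse:
  assumes "E \<in> box_entourages"
  shows "E\<inverse> \<in> box_entourages"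
proof -
  from assms obtain S K where E: "E \<subseteq> box_points G I H \<times> box_points G I H" "finite S" "S \<subseteq> carrier G"
    "finite K" "K \<subseteq> I" "E \<subseteq> orbit_rel G S \<union> box_points G K H \<times> box_points G K H"
    by (rule box_entouragesE)
  show ?thesis
  proof (rule box_entouragesI[of _ "(\<lambda>g. inv\<^bsub>G\<^esub> g) ` S" K])
    show "E\<inverse> \<subseteq> orbit_rel G ((\<lambda>g. inv\<^bsub>G\<^esub> g) ` S) \<union> box_points G K H \<times> box_points G K H"
    proof (clarify)
      fix i y j x assume a: "((j, x), (i, y)) \<in> E" and n: "((i, y), (j, x)) \<notin> orbit_rel G ((\<lambda>g. inv\<^bsub>G\<^esub> g) ` S)"
      have "((j, x), (i, y)) \<notin> orbit_rel G S"
      proof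
        assume "((j, x), (i, y)) \<in> orbit_rel G S"
        then obtain g where g: "g \<in> S" "(i, y) = box_act G g (j, x)"
          by (auto simp: orbit_rel_def)
        have "g \<in> carrier G" "(j, x) \<in> box_points G I H" using E a g by auto
        then have "box_act G (inv\<^bsub>G\<^esub> g) (i, y) = (j, x)"
          unfolding g(2) by (simp add: box_act_mult box_act_one)
        then have "((i, y), (j, x)) \<in> orbit_rel G ((\<lambda>g. inv\<^bsub>G\<^esub> g) ` S)"
          using g(1) unfolding orbit_rel_def by force
        with n show False by simp
      qed
      then show "(i, y) \<in> box_points G K H \<and> (j, x) \<in> box_points G K H"
        using E(6) a by blast
    qed
  qed (use E in auto)
qed

lemma box_entourages_relcomp:
  assumes "E \<in> box_entourages" "F \<in> box_entourages"
  shows "E O F \<in> box_entourages"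
proof -
  from assms(1) obtain S K where E: "E \<subseteq> box_points G I H \<times> box_points G I H" "finite S" "S \<subseteq> carrier G"
    "finite K" "K \<subseteq> I" "E \<subseteq> orbit_rel G S \<union> box_points G K H \<times> box_points G K H"
    by (rule box_entouragesE)
  from assms(2) obtain T L where F: "F \<subseteq> box_points G I H \<times> box_points G I H" "finite T" "T \<subseteq> carrier G"
    "finite L" "L \<subseteq> I" "F \<subseteq> orbit_rel G T \<union> box_points G L H \<times> box_points G L H"
    by (rule box_entouragesE)
  define R where "R = (\<lambda>(h, g). h \<otimes>\<^bsub>G\<^esub> g) ` (T \<times> S)"
  have "E O F \<subseteq> orbit_rel G R \<union> box_points G (K \<union> L) H \<times> box_points G (K \<union> L) H"
  proof
    fix p assume "p \<in> E O F"
    then obtain x y z where p: "p = (x, z)" and xy: "(x, y) \<in> E" and yz: "(y, z) \<in> F"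
      by auto
    have pts: "x \<in> box_points G I H" "y \<in> box_points G I H" "z \<in> box_points G I H"
      using xy yz E(1) F(1) by auto
    have 1: "(x, y) \<in> orbit_rel G S \<or> fst x \<in> K \<and> fst y \<in> K"
      using xy E(6) pts box_points_fst by blast
    have 2: "(y, z) \<in> orbit_rel G T \<or> fst y \<in> L \<and> fst z \<in> L"
      using yz F(6) pts box_points_fst by blast
    have "(x, z) \<in> orbit_rel G R \<or> fst x \<in> K \<union> L \<and> fst z \<in> K \<union> L"
    proof (cases "(x, y) \<in> orbit_rel G S \<and> (y, z) \<in> orbit_rel G T")
      case True
      then obtain g h where "g \<in> S" "h \<in> T" "y = box_act G g x" "z = box_act G h y"
        by (auto simp: orbit_rel_def)
      moreover from this have "z = box_act G (h \<otimes>\<^bsub>G\<^esub> g) x"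
        using subsetD[OF E(3)] subsetD[OF F(3)] pts by (simp add: box_act_mult)
      ultimately have "(x, z) \<in> orbit_rel G R"
        unfolding orbit_rel_def R_def by blast
      then show ?thesis by simp
    next
      case False
      with 1 2 show ?thesis
        using orbit_rel_fst[of x y G S] orbit_rel_fst[of y z G T] by fastforce
    qed
    then show "p \<in> orbit_rel G R \<union> box_points G (K \<union> L) H \<times> box_points G (K \<union> L) H"
      using p box_points_fst pts by blast
  qed
  moreover have "R \<subseteq> carrier G" "finite R"
    using E F by (auto simp: R_def)
  ultimately show ?thesis
    using E F by (intro box_entouragesI[of _ R "K \<union> L"]) auto
qed

lemma box_entourages_translate:
  assumes "E \<in> box_entourages" "g \<in> carrier G"
  shows "map_prod (box_act G g) (box_act G g) ` E \<in> box_entourages"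
proof -
  from assms(1) obtain S K where E: "E \<subseteq> box_points G I H \<times> box_points G I H" "finite S" "S \<subseteq> carrier G"
    "finite K" "K \<subseteq> I" "E \<subseteq> orbit_rel G S \<union> box_points G K H \<times> box_points G K H"
    by (rule box_entouragesE)
  define R where "R = (\<lambda>h. g \<otimes>\<^bsub>G\<^esub> h \<otimes>\<^bsub>G\<^esub> inv\<^bsub>G\<^esub> g) ` S"
  show ?thesis
  proof (rule box_entouragesI[of _ R K])
    show "map_prod (box_act G g) (box_act G g) ` E \<subseteq> box_points G I H \<times> box_points G I H"
      using E(1) box_act_closed[OF assms(2)] by auto
    show "map_prod (box_act G g) (box_act G g) ` E \<subseteq> orbit_rel G R \<union> box_points G K H \<times> box_points G K H"
    proof
      fix p assume "p \<in> map_prod (box_act G g) (box_act G g) ` E"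
      then obtain x y where p: "p = (box_act G g x, box_act G g y)" and xy: "(x, y) \<in> E"
        by auto
      have x: "x \<in> box_points G I H" using xy E(1) by auto
      consider "(x, y) \<in> orbit_rel G S" | "x \<in> box_points G K H" "y \<in> box_points G K H"
        using xy E(6) by blast
      then show "p \<in> orbit_rel G R \<union> box_points G K H \<times> box_points G K H"
      proof cases
        case 1
        then obtain h where h: "h \<in> S" "y = box_act G h x" by (auto simp: orbit_rel_def)
        then have hc: "h \<in> carrier G" using E(3) by auto
        have "box_act G (g \<otimes>\<^bsub>G\<^esub> h \<otimes>\<^bsub>G\<^esub> inv\<^bsub>G\<^esub> g) (box_act G g x) = box_act G g y"
          using hc assms(2) x h(2) by (simp add: box_act_mult m_assoc)
        then show ?thesis
          using p h(1) unfolding orbit_rel_def R_def by force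
      next
        case 2
        then show ?thesis
          using p box_act_closed_subset[OF assms(2) E(5)] by auto
      qed
    qed
  qed (use E assms(2) in \<open>auto simp: R_def\<close>)
qed

lemma box_entourages_in_structures: "box_entourages \<in> box_structures G I H"
proof -
  have "coarse_structure (box_points G I H) box_entourages"
    unfolding coarse_structure_def
  proof (intro conjI ballI allI impI)
    show "box_entourages \<subseteq> Pow (box_points G I H \<times> box_points G I H)"
      by (auto simp: box_entourages_def)
    show "Id_on (box_points G I H) \<in> box_entourages"
    proof (rule box_entouragesI[of _ "{\<one>\<^bsub>G\<^esub>}" "{}"])
      show "Id_on (box_points G I H) \<subseteq> orbit_rel G {\<one>\<^bsub>G\<^esub>} \<union> box_points G {} H \<times> box_points G {} H"
        by (auto simp: orbit_rel_def box_act_one)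
    qed auto
    show "F \<in> box_entourages" if "E \<in> box_entourages" "F \<subseteq> E" for E F
      using that unfolding box_entourages_def by blast
  qed (simp_all add: box_entourages_Un box_entourages_converse box_entourages_relcomp)
  moreover have "coarsely_connected (box_points G I H) box_entourages"
    unfolding coarsely_connected_def
  proof (intro ballI)
    fix x y assume "x \<in> box_points G I H" "y \<in> box_points G I H"
    then show "{(x, y)} \<in> box_entourages"
      by (intro box_entouragesI[of _ "{}" "{fst x, fst y}"]) (auto simp: box_points_def)
  qed
  moreover have "box_invariant G box_entourages"
    unfolding box_invariant_def by (simp add: box_entourages_translate)
  moreover have "box_Delta G I H g \<in> box_entourages" if "g \<in> carrier G" for g
    using that box_act_closed
    by (intro box_entouragesI[of _ "{g}" "{}"]) (auto simp: box_Delta_def orbit_rel_def)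
  ultimately show ?thesis
    by (simp add: box_structures_def)
qed

lemma box_coarse_eq: "box_coarse G I H = box_entourages"
proof
  show "box_coarse G I H \<subseteq> box_entourages"
    by (rule box_coarse_least(2)[of G I H, OF is_group sub box_entourages_in_structures])
  show "box_entourages \<subseteq> box_coarse G I H"
  proof
    fix E assume "E \<in> box_entourages"
    then obtain S K where E: "E \<subseteq> box_points G I H \<times> box_points G I H" "finite S" "S \<subseteq> carrier G"
      "finite K" "K \<subseteq> I" "E \<subseteq> orbit_rel G S \<union> box_points G K H \<times> box_points G K H"
      by (rule box_entouragesE)
    have str: "coarse_structure (box_points G I H) (box_coarse G I H)"
        "coarsely_connected (box_points G I H) (box_coarse G I H)"
        "\<forall>g\<in>carrier G. box_Delta G I H g \<in> box_coarse G I H"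
      using box_coarse_least(1)[of G I H, OF is_group sub] by (simp_all add: box_structures_def)
    have down: "F' \<in> box_coarse G I H" if "F \<in> box_coarse G I H" "F' \<subseteq> F" for F F'
      using str(1) that unfolding coarse_structure_def by meson
    have un: "F' \<union> F \<in> box_coarse G I H" if "F \<in> box_coarse G I H" "F' \<in> box_coarse G I H" for F F'
      using str(1) that unfolding coarse_structure_def by meson
    have "{} \<in> box_coarse G I H"
      using str(1) unfolding coarse_structure_def by blast
    have Un: "\<Union>\<F> \<in> box_coarse G I H" if "finite \<F>" "\<F> \<subseteq> box_coarse G I H" for \<F>
      using that \<open>{} \<in> box_coarse G I H\<close>
      by (induction \<F> rule: finite_induct) (auto intro: un)
    have "\<Union>(box_Delta G I H ` S) \<in> box_coarse G I H"
      using E str(3) by (intro Un) auto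
    moreover have "\<Union>((\<lambda>p. {p}) ` (box_points G K H \<times> box_points G K H)) \<in> box_coarse G I H"
      using finite_box_points[OF E(4,5)] str(2) box_points_mono[OF E(5), of G H]
      by (intro Un) (auto simp: coarsely_connected_def)
    ultimately have "\<Union>((\<lambda>p. {p}) ` (box_points G K H \<times> box_points G K H)) \<union> \<Union>(box_Delta G I H ` S)
        \<in> box_coarse G I H"
      by (rule un)
    moreover have "E \<subseteq> \<Union>((\<lambda>p. {p}) ` (box_points G K H \<times> box_points G K H)) \<union> \<Union>(box_Delta G I H ` S)"
    proof
      fix p assume "p \<in> E"
      then obtain x y where p: "p = (x, y)" "(x, y) \<in> E" "x \<in> box_points G I H"
        using E(1) by blast
      then consider "(x, y) \<in> orbit_rel G S" | "p \<in> box_points G K H \<times> box_points G K H"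
        using E(6) by blast
      then show "p \<in> \<Union>((\<lambda>p. {p}) ` (box_points G K H \<times> box_points G K H)) \<union> \<Union>(box_Delta G I H ` S)"
      proof cases
        case 1
        then obtain g where "g \<in> S" "y = box_act G g x"
          by (auto simp: orbit_rel_def)
        then have "p \<in> box_Delta G I H g"
          using p unfolding box_Delta_def by blast
        with \<open>g \<in> S\<close> show ?thesis by blast
      qed blast
    qed
    ultimately show "E \<in> box_coarse G I H"
      by (rule down)
  qed
qed

section \<open>Asymptotic dimension of box spaces\<close>

lemma box_asdim_le_iff:
  "box_asdim G I H \<le> enat n \<longleftrightarrow>
   (\<forall>S. finite S \<and> S \<subseteq> carrier G \<longrightarrow>
     (\<exists>T. finite T \<and> T \<subseteq> carrier G \<and>
        finite {i \<in> I. \<not> has_cover (box_points G {i} H) (orbit_rel G S) (orbit_rel G T) n}))"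
  (is "_ \<longleftrightarrow> ?R")
proof -
  have eq: "box_asdim G I H \<le> enat n \<longleftrightarrow>
      (\<forall>E\<in>box_entourages. \<exists>F\<in>box_entourages. has_cover (box_points G I H) E F n)"
    using asdim_leq_iff[OF coarse_structure_box] asdim_le_iff_has_cover[OF coarse_structure_box]
    by (simp add: box_asdim_def box_coarse_eq)
  show ?thesis
    unfolding eq
  proof
    assume L: "\<forall>E\<in>box_entourages. \<exists>F\<in>box_entourages. has_cover (box_points G I H) E F n"
    show ?R
    proof (intro allI impI)
      fix S assume S: "finite S \<and> S \<subseteq> carrier G"
      let ?E = "orbit_rel G S \<inter> box_points G I H \<times> box_points G I H"
      have "?E \<in> box_entourages"
        using S by (intro box_entouragesI[of _ S "{}"]) auto
      with L obtain F where F: "F \<in> box_entourages" "has_cover (box_points G I H) ?E F n"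
        by blast
      obtain T K where T: "finite T" "T \<subseteq> carrier G" "finite K" "K \<subseteq> I"
          "F \<subseteq> orbit_rel G T \<union> box_points G K H \<times> box_points G K H"
        using F(1) by (rule box_entouragesE)
      have "has_cover (box_points G {i} H) (orbit_rel G S) (orbit_rel G T) n" if "i \<in> I - K" for i
      proof (rule has_cover_mono)
        show "has_cover (box_points G {i} H) ?E F n"
          using box_points_mono[of "{i}" I G H] that by (intro has_cover_subset[OF F(2)]) auto
        show "orbit_rel G S \<inter> box_points G {i} H \<times> box_points G {i} H \<subseteq> ?E"
          using box_points_mono[of "{i}" I G H] that by auto
        show "F \<inter> box_points G {i} H \<times> box_points G {i} H \<subseteq> orbit_rel G T"
          using T(5) that by (auto simp: box_points_def)
      qed
      then have "{i \<in> I. \<not> has_cover (box_points G {i} H) (orbit_rel G S) (orbit_rel G T) n} \<subseteq> K"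
        by blast
      then have "finite {i \<in> I. \<not> has_cover (box_points G {i} H) (orbit_rel G S) (orbit_rel G T) n}"
        using T(3) by (rule finite_subset)
      then show "\<exists>T. finite T \<and> T \<subseteq> carrier G \<and>
          finite {i \<in> I. \<not> has_cover (box_points G {i} H) (orbit_rel G S) (orbit_rel G T) n}"
        using T(1,2) by blast
    qed
  next
    assume R: ?R
    show "\<forall>E\<in>box_entourages. \<exists>F\<in>box_entourages. has_cover (box_points G I H) E F n"
    proof
      fix E assume "E \<in> box_entourages"
      then obtain S K where E: "E \<subseteq> box_points G I H \<times> box_points G I H" "finite S" "S \<subseteq> carrier G"
        "finite K" "K \<subseteq> I" "E \<subseteq> orbit_rel G S \<union> box_points G K H \<times> box_points G K H"
        by (rule box_entouragesE)
      from R[rule_format, OF conjI[OF E(2,3)]] obtain T where T: "finite T" "T \<subseteq> carrier G"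
        "finite {i \<in> I. \<not> has_cover (box_points G {i} H) (orbit_rel G S) (orbit_rel G T) n}"
        by blast
      define L where
        "L = K \<union> {i \<in> I. \<not> has_cover (box_points G {i} H) (orbit_rel G S) (orbit_rel G T) n}"
      have L: "finite L" "L \<subseteq> I" "K \<subseteq> L"
        using E T by (auto simp: L_def)
      define F where "F = (orbit_rel G T \<union> box_points G L H \<times> box_points G L H) \<inter>
         box_points G I H \<times> box_points G I H"
      have "F \<in> box_entourages"
        using T L by (intro box_entouragesI[of _ T L]) (auto simp: F_def)
      moreover have "has_cover (box_points G I H) E F n"
      proof -
        define \<P> where "\<P> = insert (box_points G L H) ((\<lambda>i. box_points G {i} H) ` (I - L))"
        have X: "box_points G I H = \<Union>\<P>"
          using L(2) unfolding \<P>_def by (auto simp: box_points_def)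
        have "has_cover (\<Union>\<P>) E F n"
        proof (rule has_cover_Union)
          show "pairwise disjnt \<P>"
            unfolding \<P>_def by (auto simp: pairwise_def disjnt_iff box_points_def)
          show "E \<inter> \<Union>\<P> \<times> \<Union>\<P> \<subseteq> (\<Union>P\<in>\<P>. P \<times> P)"
          proof
            fix p assume "p \<in> E \<inter> \<Union>\<P> \<times> \<Union>\<P>"
            then obtain x y where p: "p = (x, y)" "(x, y) \<in> E"
              and x: "x \<in> box_points G I H" and y: "y \<in> box_points G I H"
              using E(1) by blast
            from p E(6) consider "fst y = fst x" | "x \<in> box_points G K H" "y \<in> box_points G K H"
              using orbit_rel_fst by blast
            then have "fst x \<in> L \<and> fst y \<in> L \<or> fst x \<in> I - L \<and> fst y = fst x"
              using x L(3) by cases (auto simp: box_points_def)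
            then show "p \<in> (\<Union>P\<in>\<P>. P \<times> P)"
              using p x y unfolding \<P>_def by (auto simp: box_points_def)
          qed
          fix P assume "P \<in> \<P>"
          then consider "P = box_points G L H" | i where "i \<in> I - L" "P = box_points G {i} H"
            unfolding \<P>_def by blast
          then show "has_cover P E F n"
          proof cases
            case 1
            then show ?thesis
              using has_cover_mono[OF has_cover_self, of E "box_points G L H" E F n] box_points_mono[OF L(2), of G H]
              by (auto simp: F_def)
          next
            case 2
            have "has_cover P (orbit_rel G S) (orbit_rel G T) n"
              using 2 by (auto simp: L_def)
            then show ?thesis
            proof (rule has_cover_mono)
              show "E \<inter> P \<times> P \<subseteq> orbit_rel G S"
                using E(6) 2 L(3) by (auto simp: box_points_def)
              show "orbit_rel G T \<inter> P \<times> P \<subseteq> F"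
                using 2 box_points_mono[of "{i}" I G H] by (auto simp: F_def)
            qed
          qed
        qed
        then show ?thesis using X by simp
      qed
      ultimately show "\<exists>F\<in>box_entourages. has_cover (box_points G I H) E F n" by blast
    qed
  qed
qed

lemma box_asdim_mono:
  assumes "J \<subseteq> I"
  shows "box_asdim G J H \<le> box_asdim G I H"
proof -
  interpret J: box_family G J H by (rule box_family_subset[OF assms])
  show ?thesis
  proof (rule enat_le_by_bounds)
    fix n assume "box_asdim G I H \<le> enat n"
    then show "box_asdim G J H \<le> enat n"
      unfolding box_asdim_le_iff J.box_asdim_le_iff
    proof (elim all_forward imp_forward ex_forward conj_forward)
      fix S T
      assume "finite {i \<in> I. \<not> has_cover (box_points G {i} H) (orbit_rel G S) (orbit_rel G T) n}"
      then show "finite {i \<in> J. \<not> has_cover (box_points G {i} H) (orbit_rel G S) (orbit_rel G T) n}"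
        by (rule rev_finite_subset) (use assms in blast)
    qed
  qed
qed

lemma box_asdim_le_SUP_countable:
  assumes "countable (carrier G)"
  shows "box_asdim G I H \<le> (SUP J\<in>{J. J \<subseteq> I \<and> countable J}. box_asdim G J H)"
proof (rule enat_le_by_bounds)
  fix n assume "(SUP J\<in>{J. J \<subseteq> I \<and> countable J}. box_asdim G J H) \<le> enat n"
  then have le: "box_asdim G J H \<le> enat n" if "J \<subseteq> I" "countable J" for J
    using that by (auto simp: SUP_le_iff)
  let ?bad = "\<lambda>S T. {i \<in> I. \<not> has_cover (box_points G {i} H) (orbit_rel G S) (orbit_rel G T) n}"
  show "box_asdim G I H \<le> enat n"
    unfolding box_asdim_le_iff
  proof (intro allI impI, rule ccontr)
    fix S assume S: "finite S \<and> S \<subseteq> carrier G"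
    let ?\<T> = "{T. finite T \<and> T \<subseteq> carrier G}"
    assume no: "\<not> (\<exists>T. finite T \<and> T \<subseteq> carrier G \<and> finite (?bad S T))"
    have "\<forall>T\<in>?\<T>. \<exists>B\<subseteq>?bad S T. countable B \<and> infinite B"
      using no by (intro ballI infinite_countable_subset') auto
    from bchoice[OF this] obtain B
      where "\<forall>T\<in>?\<T>. B T \<subseteq> ?bad S T \<and> countable (B T) \<and> infinite (B T)"
      by (elim exE)
    then have B: "\<And>T. T \<in> ?\<T> \<Longrightarrow> B T \<subseteq> ?bad S T"
      "\<And>T. T \<in> ?\<T> \<Longrightarrow> countable (B T)" "\<And>T. T \<in> ?\<T> \<Longrightarrow> infinite (B T)"
      by simp_all
    define J where "J = (\<Union>T\<in>?\<T>. B T)"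
    have "J \<subseteq> I"
      unfolding J_def using B(1) by (intro UN_least) blast
    interpret J: box_family G J H by (rule box_family_subset[OF \<open>J \<subseteq> I\<close>])
    have "countable ?\<T>"
      using countable_Collect_finite_subset[OF assms] by simp
    then have "countable J"
      unfolding J_def using B(2) by (rule countable_UN)
    then have "box_asdim G J H \<le> enat n"
      using le \<open>J \<subseteq> I\<close> by simp
    from this[unfolded J.box_asdim_le_iff, rule_format, OF S] obtain T where T: "finite T" "T \<subseteq> carrier G"
        "finite {i \<in> J. \<not> has_cover (box_points G {i} H) (orbit_rel G S) (orbit_rel G T) n}"
      by blast
    have "B T \<subseteq> {i \<in> J. \<not> has_cover (box_points G {i} H) (orbit_rel G S) (orbit_rel G T) n}"
      using B(1)[of T] T unfolding J_def by blast
    then have "finite (B T)"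
      using T(3) by (rule finite_subset)
    with B(3)[of T] T show False by simp
  qed
qed

end

lemma nested_family_countable_hull:
  assumes "nested_family I H" "J \<subseteq> I" "countable J"
  obtains J' where "J \<subseteq> J'" "J' \<subseteq> I" "countable J'" "nested_family J' H"
proof -
  obtain k where k: "\<And>i j. i \<in> I \<Longrightarrow> j \<in> I \<Longrightarrow> k i j \<in> I \<and> H (k i j) \<subseteq> H i \<inter> H j"
    using assms(1) unfolding nested_family_def by metis
  define f where "f = (\<lambda>A. A \<union> (\<lambda>(i, j). k i j) ` (A \<times> A))"
  define A where "A = (\<lambda>n. (f ^^ n) J)"
  have step: "A (Suc n) = A n \<union> (\<lambda>(i, j). k i j) ` (A n \<times> A n)" for n
    by (simp add: A_def f_def)
  have A: "A n \<subseteq> I \<and> countable (A n)" for n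
  proof (induction n)
    case 0
    then show ?case using assms by (simp add: A_def)
  next
    case (Suc n)
    then show ?case unfolding step using k by auto
  qed
  have "mono A"
    by (rule monoI, rule lift_Suc_mono_le) (auto simp: step)
  show ?thesis
  proof
    show "J \<subseteq> (\<Union>n. A n)"
      by (auto simp: A_def intro!: exI[of _ 0])
    show "(\<Union>n. A n) \<subseteq> I" "countable (\<Union>n. A n)"
      using A by auto
    show "nested_family (\<Union>n. A n) H"
      unfolding nested_family_def
    proof (intro ballI)
      fix i j assume "i \<in> (\<Union>n. A n)" "j \<in> (\<Union>n. A n)"
      then obtain m n where "i \<in> A m" "j \<in> A n" by blast
      then have ij: "i \<in> A (max m n)" "j \<in> A (max m n)"
        using monoD[OF \<open>mono A\<close>, of m "max m n"] monoD[OF \<open>mono A\<close>, of n "max m n"] by auto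
      then have "k i j \<in> A (Suc (max m n))"
        by (auto simp: step)
      moreover have "H (k i j) \<subseteq> H i \<inter> H j"
        using k A ij by blast
      ultimately show "\<exists>l\<in>(\<Union>n. A n). H l \<subseteq> H i \<inter> H j" by blast
    qed
  qed
qed

theorem proposition3p7:
  fixes G :: "('a, 'b) monoid_scheme" and I :: "'i set" and H :: "'i \<Rightarrow> 'a set"
  assumes "group G" and "countable (carrier G)"
    and "\<And>i. i \<in> I \<Longrightarrow> subgroup (H i) G"
    and "\<And>i. i \<in> I \<Longrightarrow> finite (lcosets\<^bsub>G\<^esub> (H i))"
  shows "box_asdim G I H = (SUP J\<in>{J. J \<subseteq> I \<and> countable J}. box_asdim G J H) \<and>
    (nested_family I H \<longrightarrow>
       box_asdim G I H = (SUP J\<in>{J. J \<subseteq> I \<and> countable J \<and> nested_family J H}. box_asdim G J H))"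
proof -
  have fam: "box_family G I H"
    using assms by (simp add: box_family_def box_family_axioms_def)
  note upper = box_family.box_asdim_mono[OF fam]
    and lower = box_family.box_asdim_le_SUP_countable[OF fam assms(2)]
  show ?thesis
  proof (intro conjI impI)
    show "box_asdim G I H = (SUP J\<in>{J. J \<subseteq> I \<and> countable J}. box_asdim G J H)"
      using upper by (intro antisym lower SUP_least) auto
    assume nested: "nested_family I H"
    have "(SUP J\<in>{J. J \<subseteq> I \<and> countable J}. box_asdim G J H)
        \<le> (SUP J\<in>{J. J \<subseteq> I \<and> countable J \<and> nested_family J H}. box_asdim G J H)"
    proof (rule SUP_mono)
      fix J assume "J \<in> {J. J \<subseteq> I \<and> countable J}"
      then obtain J' where J': "J \<subseteq> J'" "J' \<subseteq> I" "countable J'" "nested_family J' H"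
        using nested_family_countable_hull[OF nested] by (metis mem_Collect_eq)
      have "box_asdim G J H \<le> box_asdim G J' H"
        using box_family.box_asdim_mono[OF box_family.box_family_subset[OF fam J'(2)] J'(1)] .
      with J' show "\<exists>J'\<in>{J. J \<subseteq> I \<and> countable J \<and> nested_family J H}. box_asdim G J H \<le> box_asdim G J' H"
        by blast
    qed
    with lower show "box_asdim G I H = (SUP J\<in>{J. J \<subseteq> I \<and> countable J \<and> nested_family J H}. box_asdim G J H)"
      using upper by (intro antisym SUP_least) (auto intro: order.trans)
  qed
qed

end
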